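(* Let $K$ be a field. Let $M\in L(K^{\mathbb{N}_0})$ be such that $M_{0j}=\delta_{0j}$ for all $j$, $M_{kj}=0$ for $j>k+1$, and for all $k\in\mathbb{N}_0$ $$Y^k M=\sum_{j=0}^{k+1} M_{kj}\,M^{k+1-j}\,Y^j .\qquad ( * )$$ Then the linear maps $\gamma^r_j:K[x]\to K[x]$ ($r,j\in\mathbb{N}_0$) given by $$\gamma^r_j(x^i):=(M^i)_{rj}\,x^{r+i-j}\qquad ( ** )$$ (read as $0$ when $j>r+i$, where $(M^i)_{rj}=0$) determine a graded twisting map $\tau:K[y]\otimes K[x]\to K[x]\otimes K[y]$ via $\tau(y^r\otimes f)=\sum_j\gamma^r_j(f)\otimes y^j$. Conversely, if $\tau:K[y]\otimes K[x]\to K[x]\otimes K[y]$ is a graded twisting map, then the corresponding maps $\gamma^r_j$ determine via $( ** )$ a matrix $M\in L(K^{\mathbb{N}_0})$ satisfying $( * )$ for all $k\in\mathbb{N}_0$, $M_{0j}=\delta_{0j}$ for all $j$, and $M_{kj}=0$ for $j>k+1$.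
   Context: $\mathbb{N}_0=\{0,1,2,\dots\}$. Tensor products are over $K$; $\mu_{K[x]},\mu_{K[y]}$ denote the multiplication maps. $L(K^{\mathbb{N}_0})$ is the algebra of infinite matrices with entries in $K$, indexed by $\mathbb{N}_0\times\mathbb{N}_0$, such that each row has only finitely many nonzero entries. $Y$ is the matrix with $Y_{ij}=\delta_{i+1,j}$. A twisting map is a $K$-linear map $\tau:K[y]\otimes K[x]\to K[x]\otimes K[y]$ such that $\tau(1\otimes f)=f\otimes 1$ and $\tau(y^r\otimes 1)=1\otimes y^r$ for all $f\in K[x]$, $r\ge 0$; $\tau\circ(\mathrm{id}_{K[y]}\otimes\mu_{K[x]})=(\mu_{K[x]}\otimes \mathrm{id}_{K[y]})\circ(\mathrm{id}_{K[x]}\otimes\tau)\circ(\tau\otimes \mathrm{id}_{K[x]})$; and $\tau\circ(\mu_{K[y]}\otimes\mathrm{id}_{K[x]})=(\mathrm{id}_{K[x]}\otimes\mu_{K[y]})\circ(\tau\otimes\mathrm{id}_{K[y]})\circ(\mathrm{id}_{K[y]}\otimes\tau)$. A linear map $\tau:K[y]\otimes K[x]\to K[x]\otimes K[y]$ is equivalent to a family of linear maps $\gamma^r_j:K[x]\to K[x]$ (with, for fixed $r,f$, $\gamma^r_j(f)=0$ for $j$ large) via $\tau(y^r\otimes f)=\sum_j\gamma^r_j(f)\otimes y^j$. The map $\tau$ is graded if $\tau(y^r\otimes x^i)$ lies in the span of $\{x^{r+i-j}\otimes y^j:0\le j\le r+i\}$ for all $r,i$. *)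

theory Defs
  imports "HOL-Computational_Algebra.Polynomial" "HOL-Library.Poly_Mapping"
begin

section \<open>The algebra of row-finite matrices\<close>

typedef (overloaded) 'a rfmat = "{A :: nat \<Rightarrow> nat \<Rightarrow> 'a::zero. \<forall>i. finite {j. A i j \<noteq> 0}}"
  morphisms entry Rfmat
  by (rule exI[of _ "\<lambda>_ _. 0"]) simp

setup_lifting type_definition_rfmat

lemma finite_row: "finite {j. entry A i j \<noteq> 0}"
  using entry[of A] by simp

lemma rfmat_eqI: "(\<And>i j. entry A i j = entry B i j) \<Longrightarrow> A = B"
  by (metis entry_inject ext)

lemma row_finite_mult:
  fixes A B :: "nat \<Rightarrow> nat \<Rightarrow> 'a::semiring_0"
  assumes "\<And>i. finite {j. A i j \<noteq> 0}" "\<And>i. finite {j. B i j \<noteq> 0}"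
  shows "finite {j. (\<Sum>k | A i k \<noteq> 0. A i k * B k j) \<noteq> 0}"
proof (rule finite_subset)
  show "{j. (\<Sum>k | A i k \<noteq> 0. A i k * B k j) \<noteq> 0} \<subseteq> (\<Union>k\<in>{k. A i k \<noteq> 0}. {j. B k j \<noteq> 0})"
  proof
    fix j assume "j \<in> {j. (\<Sum>k | A i k \<noteq> 0. A i k * B k j) \<noteq> 0}"
    then obtain k where "A i k \<noteq> 0" "A i k * B k j \<noteq> 0"
      by (metis (mono_tags, lifting) mem_Collect_eq sum.neutral)
    then show "j \<in> (\<Union>k\<in>{k. A i k \<noteq> 0}. {j. B k j \<noteq> 0})" by auto
  qed
  show "finite (\<Union>k\<in>{k. A i k \<noteq> 0}. {j. B k j \<noteq> 0})" using assms by auto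
qed

instantiation rfmat :: (comm_ring_1) ring_1
begin

lift_definition zero_rfmat :: "'a rfmat" is "\<lambda>_ _. 0" by simp

lift_definition one_rfmat :: "'a rfmat" is "\<lambda>i j. if i = j then 1 else 0" by simp

lift_definition plus_rfmat :: "'a rfmat \<Rightarrow> 'a rfmat \<Rightarrow> 'a rfmat" is "\<lambda>A B i j. A i j + B i j"
proof -
  fix A B :: "nat \<Rightarrow> nat \<Rightarrow> 'a" and i
  assume "\<And>i. finite {j. A i j \<noteq> 0}" "\<And>i. finite {j. B i j \<noteq> 0}"
  then show "finite {j. A i j + B i j \<noteq> 0}"
    by - (rule finite_subset[of _ "{j. A i j \<noteq> 0} \<union> {j. B i j \<noteq> 0}"], auto)
qed

lift_definition uminus_rfmat :: "'a rfmat \<Rightarrow> 'a rfmat" is "\<lambda>A i j. - A i j" by simp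

lift_definition minus_rfmat :: "'a rfmat \<Rightarrow> 'a rfmat \<Rightarrow> 'a rfmat" is "\<lambda>A B i j. A i j - B i j"
proof -
  fix A B :: "nat \<Rightarrow> nat \<Rightarrow> 'a" and i
  assume "\<And>i. finite {j. A i j \<noteq> 0}" "\<And>i. finite {j. B i j \<noteq> 0}"
  then show "finite {j. A i j - B i j \<noteq> 0}"
    by - (rule finite_subset[of _ "{j. A i j \<noteq> 0} \<union> {j. B i j \<noteq> 0}"], auto)
qed

lift_definition times_rfmat :: "'a rfmat \<Rightarrow> 'a rfmat \<Rightarrow> 'a rfmat"
  is "\<lambda>A B i j. \<Sum>k | A i k \<noteq> 0. A i k * B k j"
  by (rule row_finite_mult)

lemma entry_times_superset:
  fixes A B :: "'a rfmat"
  assumes "finite S" "{k. entry A i k \<noteq> 0} \<subseteq> S"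
  shows "entry (A * B) i j = (\<Sum>k\<in>S. entry A i k * entry B k j)"
  unfolding times_rfmat.rep_eq using assms by (intro sum.mono_neutral_left) auto

instance
proof
  fix A B C :: "'a rfmat"
  show "A + B + C = A + (B + C)" by transfer (simp add: add.assoc)
  show "A + B = B + A" by transfer (simp add: add.commute)
  show "0 + A = A" by transfer simp
  show "- A + A = 0" by transfer simp
  show "A - B = A + - B" by transfer simp
  show "1 * A = A"
  proof (rule rfmat_eqI)
    fix i j
    have "entry (1 * A) i j = (\<Sum>k\<in>{i}. entry 1 i k * entry A k j)"
      by (rule entry_times_superset) (auto simp: one_rfmat.rep_eq)
    then show "entry (1 * A) i j = entry A i j" by (simp add: one_rfmat.rep_eq)
  qed
  show "A * 1 = A"
  proof (rule rfmat_eqI)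
    fix i j
    have "entry (A * 1) i j = (\<Sum>k\<in>insert j {k. entry A i k \<noteq> 0}. entry A i k * entry 1 k j)"
      by (rule entry_times_superset) (auto simp: finite_row)
    also have "\<dots> = entry A i j"
      by (subst sum.remove[of _ j]) (auto simp: finite_row one_rfmat.rep_eq intro!: sum.neutral)
    finally show "entry (A * 1) i j = entry A i j" .
  qed
  show "(A + B) * C = A * C + B * C"
  proof (rule rfmat_eqI)
    fix i j
    let ?S = "{k. entry A i k \<noteq> 0} \<union> {k. entry B i k \<noteq> 0}"
    have f: "finite ?S" by (simp add: finite_row)
    have "entry ((A + B) * C) i j = (\<Sum>k\<in>?S. entry (A + B) i k * entry C k j)"
      by (rule entry_times_superset[OF f]) (auto simp: plus_rfmat.rep_eq)
    also have "\<dots> = (\<Sum>k\<in>?S. entry A i k * entry C k j) + (\<Sum>k\<in>?S. entry B i k * entry C k j)"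
      by (simp add: plus_rfmat.rep_eq distrib_right sum.distrib)
    also have "(\<Sum>k\<in>?S. entry A i k * entry C k j) = entry (A * C) i j"
      by (rule entry_times_superset[OF f, symmetric]) auto
    also have "(\<Sum>k\<in>?S. entry B i k * entry C k j) = entry (B * C) i j"
      by (rule entry_times_superset[OF f, symmetric]) auto
    finally show "entry ((A + B) * C) i j = entry (A * C + B * C) i j"
      by (simp add: plus_rfmat.rep_eq)
  qed
  show "A * (B + C) = A * B + A * C"
    by transfer (simp add: distrib_left sum.distrib)
  show "A * B * C = A * (B * C)"
  proof (rule rfmat_eqI)
    fix i j
    let ?S = "{k. entry A i k \<noteq> 0}" and ?T = "\<Union>k\<in>{k. entry A i k \<noteq> 0}. {l. entry B k l \<noteq> 0}"
    have f: "finite ?S" "finite ?T" by (auto simp: finite_row)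
    have sub: "{l. entry (A * B) i l \<noteq> 0} \<subseteq> ?T"
    proof
      fix l assume "l \<in> {l. entry (A * B) i l \<noteq> 0}"
      then obtain k where "entry A i k \<noteq> 0" "entry A i k * entry B k l \<noteq> 0"
        unfolding times_rfmat.rep_eq by (metis (mono_tags, lifting) mem_Collect_eq sum.neutral)
      then show "l \<in> ?T" by auto
    qed
    have "entry (A * B * C) i j = (\<Sum>l\<in>?T. entry (A * B) i l * entry C l j)"
      by (rule entry_times_superset[OF f(2) sub])
    also have "\<dots> = (\<Sum>l\<in>?T. \<Sum>k\<in>?S. entry A i k * entry B k l * entry C l j)"
      by (simp add: times_rfmat.rep_eq sum_distrib_right)
    also have "\<dots> = (\<Sum>k\<in>?S. \<Sum>l\<in>?T. entry A i k * entry B k l * entry C l j)"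
      by (rule sum.swap)
    also have "\<dots> = (\<Sum>k\<in>?S. entry A i k * entry (B * C) k j)"
    proof (rule sum.cong[OF refl])
      fix k assume "k \<in> ?S"
      then have "entry (B * C) k j = (\<Sum>l\<in>?T. entry B k l * entry C l j)"
        by (intro entry_times_superset[OF f(2)]) auto
      then show "(\<Sum>l\<in>?T. entry A i k * entry B k l * entry C l j) = entry A i k * entry (B * C) k j"
        by (simp add: sum_distrib_left mult.assoc)
    qed
    also have "\<dots> = entry (A * (B * C)) i j"
      by (simp add: times_rfmat.rep_eq)
    finally show "entry (A * B * C) i j = entry (A * (B * C)) i j" .
  qed
  show "(0 :: 'a rfmat) \<noteq> 1"
    by transfer (metis zero_neq_one)
qed

end

lift_definition mscale :: "'a::comm_ring_1 \<Rightarrow> 'a rfmat \<Rightarrow> 'a rfmat" is "\<lambda>c A i j. c * A i j"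
proof -
  fix c :: 'a and A :: "nat \<Rightarrow> nat \<Rightarrow> 'a" and i
  assume "\<And>i. finite {j. A i j \<noteq> 0}"
  then show "finite {j. c * A i j \<noteq> 0}"
    by (rule finite_subset[of _ "{j. A i j \<noteq> 0}", rotated]) auto
qed

lift_definition Y_mat :: "'a::comm_ring_1 rfmat" is "\<lambda>i j. if i + 1 = j then 1 else 0"
  by simp

definition twisting_matrix :: "'a::comm_ring_1 rfmat \<Rightarrow> bool" where
  "twisting_matrix M \<longleftrightarrow>
     (\<forall>j. entry M 0 j = (if j = 0 then 1 else 0)) \<and>
     (\<forall>k j. j > k + 1 \<longrightarrow> entry M k j = 0) \<and>
     (\<forall>k. Y_mat ^ k * M = (\<Sum>j = 0..k + 1. mscale (entry M k j) (M ^ (k + 1 - j) * Y_mat ^ j)))"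


section \<open>Tensor products of polynomial algebras\<close>

type_synonym 'a tens2 = "nat \<times> nat \<Rightarrow>\<^sub>0 'a"
type_synonym 'a tens3 = "nat \<times> nat \<times> nat \<Rightarrow>\<^sub>0 'a"

text \<open>
  The tensor product of two (three) one-variable polynomial algebras is modelled on the basis of
  tensors of monomials: the coefficient of a tensor at \<^term>\<open>(i, j)\<close> belongs to the \<open>i\<close>-th power of
  the variable of the first factor tensor the \<open>j\<close>-th power of the variable of the second one.
  Hence \<open>K[y] \<otimes> K[x]\<close> and \<open>K[x] \<otimes> K[y]\<close> are both \<^typ>\<open>'a tens2\<close>; which variable belongs to which
  factor is a matter of position. The three-fold products are bracketed neither way, see
  \<open>tens_right_tensor\<close>. The universal properties are \<open>tensor_universal\<close> and \<open>tensor3_universal\<close>.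
\<close>

lift_definition pscale :: "'a::comm_ring_1 \<Rightarrow> ('i \<Rightarrow>\<^sub>0 'a) \<Rightarrow> ('i \<Rightarrow>\<^sub>0 'a)" is "\<lambda>c t i. c * t i"
  by (rule rev_finite_subset) auto

lift_definition tensor :: "'a::comm_ring_1 poly \<Rightarrow> 'a poly \<Rightarrow> 'a tens2"
  is "\<lambda>f g (i, j). f i * g j"
  subgoal for f g
    unfolding MOST_iff_cofinite
    by (rule finite_subset[of _ "{i. f i \<noteq> 0} \<times> {j. g j \<noteq> 0}"]) auto
  done

text \<open>\<open>t \<otimes> h\<close> and \<open>f \<otimes> t\<close> for a two-fold tensor \<open>t\<close>\<close>

lift_definition tens_right :: "'a::comm_ring_1 tens2 \<Rightarrow> 'a poly \<Rightarrow> 'a tens3"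
  is "\<lambda>t h (i, j, k). t (i, j) * h k"
  subgoal for t h
    unfolding MOST_iff_cofinite
    by (rule finite_subset[of _ "(\<lambda>((i, j), k). (i, j, k)) ` ({p. t p \<noteq> 0} \<times> {k. h k \<noteq> 0})"])
       (auto simp: image_iff)
  done

lift_definition tens_left :: "'a::comm_ring_1 poly \<Rightarrow> 'a tens2 \<Rightarrow> 'a tens3"
  is "\<lambda>f t (i, j, k). f i * t (j, k)"
  subgoal for f t
    unfolding MOST_iff_cofinite
    by (rule finite_subset[of _ "{i. f i \<noteq> 0} \<times> {p. t p \<noteq> 0}"]) auto
  done

definition tensor3 :: "'a::comm_ring_1 poly \<Rightarrow> 'a poly \<Rightarrow> 'a poly \<Rightarrow> 'a tens3" where
  "tensor3 f g h = tens_left f (tensor g h)"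

lemma tens_right_tensor: "tens_right (tensor f g) h = tensor3 f g h"
  unfolding tensor3_def by transfer (auto simp: mult.assoc)

text \<open>The linear map with prescribed values on the standard basis\<close>

definition lin_ext :: "('a::zero \<Rightarrow> 'v \<Rightarrow> 'v) \<Rightarrow> ('i \<Rightarrow> 'v::comm_monoid_add) \<Rightarrow> ('i \<Rightarrow>\<^sub>0 'a) \<Rightarrow> 'v" where
  "lin_ext s \<phi> t = (\<Sum>i\<in>Poly_Mapping.keys t. s (Poly_Mapping.lookup t i) (\<phi> i))"

abbreviation X :: "nat \<Rightarrow> 'a::comm_ring_1 poly" where
  "X n \<equiv> monom 1 n"

text \<open>\<open>\<mu> \<otimes> id\<close> and \<open>id \<otimes> \<mu>\<close>, followed by \<open>\<phi> \<otimes> id\<close> and \<open>id \<otimes> \<phi>\<close> for linear \<open>\<phi>\<close>; their values on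
  arbitrary pure tensors are in \<open>mult_id_tensor3\<close>, \<open>id_mult_tensor3\<close>, \<open>map_id_tens_right\<close> and
  \<open>id_map_tens_left\<close>.\<close>

definition mult_id :: "'a::comm_ring_1 tens3 \<Rightarrow> 'a tens2" where
  "mult_id = lin_ext pscale (\<lambda>(i, j, k). tensor (X i * X j) (X k))"

definition id_mult :: "'a::comm_ring_1 tens3 \<Rightarrow> 'a tens2" where
  "id_mult = lin_ext pscale (\<lambda>(i, j, k). tensor (X i) (X j * X k))"

definition map_id :: "('a::comm_ring_1 tens2 \<Rightarrow> 'a tens2) \<Rightarrow> 'a tens3 \<Rightarrow> 'a tens3" where
  "map_id \<phi> = lin_ext pscale (\<lambda>(i, j, k). tens_right (\<phi> (tensor (X i) (X j))) (X k))"

definition id_map :: "('a::comm_ring_1 tens2 \<Rightarrow> 'a tens2) \<Rightarrow> 'a tens3 \<Rightarrow> 'a tens3" where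
  "id_map \<phi> = lin_ext pscale (\<lambda>(i, j, k). tens_left (X i) (\<phi> (tensor (X j) (X k))))"

lemma lookup_pscale [simp]: "Poly_Mapping.lookup (pscale c t) i = c * Poly_Mapping.lookup t i"
  by transfer simp

lemma lookup_tensor [simp]: "Poly_Mapping.lookup (tensor f g) (i, j) = coeff f i * coeff g j"
  by transfer simp

lemma lookup_tens_right [simp]: "Poly_Mapping.lookup (tens_right t h) (i, j, k) = Poly_Mapping.lookup t (i, j) * coeff h k"
  by transfer simp

lemma lookup_tens_left [simp]: "Poly_Mapping.lookup (tens_left f t) (i, j, k) = coeff f i * Poly_Mapping.lookup t (j, k)"
  by transfer simp

lemma tensor_X: "tensor (X i) (X j) = Poly_Mapping.single (i, j) 1"
  by (rule poly_mapping_eqI) (auto simp: lookup_single when_def split: if_splits)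

lemma tensor3_X: "tensor3 (X i) (X j) (X k) = Poly_Mapping.single (i, j, k) 1"
  unfolding tensor3_def by (rule poly_mapping_eqI) (auto simp: lookup_single when_def split: if_splits)

lemma vector_space_pscale: "vector_space (pscale :: 'a::field \<Rightarrow> _)"
  by standard (auto intro!: poly_mapping_eqI simp: lookup_add algebra_simps)

lemma vector_space_smult: "vector_space (smult :: 'a::field \<Rightarrow> _)"
  by standard (auto simp: smult_add_right smult_add_left)

lemma lin_ext_superset:
  assumes "vector_space s" "finite S" "Poly_Mapping.keys t \<subseteq> S"
  shows "lin_ext s \<phi> t = (\<Sum>i\<in>S. s (Poly_Mapping.lookup t i) (\<phi> i))"
proof -
  interpret vector_space s by fact
  show ?thesis unfolding lin_ext_def using assms(2,3)
    by (intro sum.mono_neutral_left) (auto simp: in_keys_iff)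
qed

lemma linear_lin_ext:
  fixes s :: "'a::field \<Rightarrow> 'v::ab_group_add \<Rightarrow> 'v" and \<phi> :: "'i \<Rightarrow> 'v"
  assumes "vector_space s"
  shows "Vector_Spaces.linear pscale s (lin_ext s \<phi>)"
proof -
  interpret vector_space s by fact
  show ?thesis unfolding Vector_Spaces.linear_iff
  proof (intro conjI allI vector_space_pscale assms)
    fix t u :: "'i \<Rightarrow>\<^sub>0 'a"
    let ?S = "Poly_Mapping.keys t \<union> Poly_Mapping.keys u"
    have "lin_ext s \<phi> (t + u) = (\<Sum>i\<in>?S. s (Poly_Mapping.lookup (t + u) i) (\<phi> i))"
      by (rule lin_ext_superset[OF assms]) (auto simp: keys_add)
    also have "\<dots> = (\<Sum>i\<in>?S. s (Poly_Mapping.lookup t i) (\<phi> i)) + (\<Sum>i\<in>?S. s (Poly_Mapping.lookup u i) (\<phi> i))"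
      by (simp add: lookup_add scale_left_distrib sum.distrib)
    also have "\<dots> = lin_ext s \<phi> t + lin_ext s \<phi> u"
      by (simp add: lin_ext_superset[OF assms, of ?S])
    finally show "lin_ext s \<phi> (t + u) = lin_ext s \<phi> t + lin_ext s \<phi> u" .
  next
    fix c and t :: "'i \<Rightarrow>\<^sub>0 'a"
    have "lin_ext s \<phi> (pscale c t) = (\<Sum>i\<in>Poly_Mapping.keys t. s (Poly_Mapping.lookup (pscale c t) i) (\<phi> i))"
      by (rule lin_ext_superset[OF assms]) (auto simp: in_keys_iff)
    also have "\<dots> = s c (lin_ext s \<phi> t)"
      by (simp add: lin_ext_def scale_sum_right)
    finally show "lin_ext s \<phi> (pscale c t) = s c (lin_ext s \<phi> t)" .
  qed
qed

lemma lin_ext_single: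
  assumes "vector_space s"
  shows "lin_ext s \<phi> (Poly_Mapping.single i (1::'a::field)) = \<phi> i"
proof -
  interpret vector_space s by fact
  show ?thesis by (simp add: lin_ext_def)
qed

lemma pm_linear_eq_lin_ext:
  fixes L :: "('i \<Rightarrow>\<^sub>0 'a::field) \<Rightarrow> 'v::ab_group_add"
  assumes "Vector_Spaces.linear pscale s L"
  shows "L t = lin_ext s (\<lambda>i. L (Poly_Mapping.single i 1)) t"
proof -
  interpret Vector_Spaces.linear pscale s L by fact
  have "t = (\<Sum>i\<in>Poly_Mapping.keys t. pscale (Poly_Mapping.lookup t i) (Poly_Mapping.single i 1))"
    by (rule poly_mapping_eqI)
       (auto simp: lookup_sum lookup_single when_def in_keys_iff if_distrib cong: if_cong)
  then have "L t = L (\<Sum>i\<in>Poly_Mapping.keys t. pscale (Poly_Mapping.lookup t i) (Poly_Mapping.single i 1))" by simp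
  then show ?thesis unfolding lin_ext_def by (simp add: sum scale)
qed

lemma pm_linear_eqI:
  fixes L L' :: "('i \<Rightarrow>\<^sub>0 'a::field) \<Rightarrow> 'v::ab_group_add"
  assumes "Vector_Spaces.linear pscale s L" "Vector_Spaces.linear pscale s L'"
    and "\<And>i. L (Poly_Mapping.single i 1) = L' (Poly_Mapping.single i 1)"
  shows "L = L'"
proof
  fix t
  have "L t = lin_ext s (\<lambda>i. L (Poly_Mapping.single i 1)) t"
    by (rule pm_linear_eq_lin_ext[OF assms(1)])
  also have "\<dots> = lin_ext s (\<lambda>i. L' (Poly_Mapping.single i 1)) t"
    by (simp only: assms(3))
  also have "\<dots> = L' t"
    by (rule pm_linear_eq_lin_ext[OF assms(2), symmetric])
  finally show "L t = L' t" .
qed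

lemma poly_linear_eqI:
  fixes L L' :: "'a::field poly \<Rightarrow> 'v::ab_group_add"
  assumes "Vector_Spaces.linear smult s L" "Vector_Spaces.linear smult s L'"
    and "\<And>i. L (X i) = L' (X i)"
  shows "L f = L' f"
proof -
  interpret L: Vector_Spaces.linear smult s L by fact
  interpret L': Vector_Spaces.linear smult s L' by fact
  have "f = (\<Sum>i\<le>degree f. smult (coeff f i) (X i))"
    by (simp add: smult_monom poly_as_sum_of_monoms)
  then have "L f = L (\<Sum>i\<le>degree f. smult (coeff f i) (X i))"
    "L' f = L' (\<Sum>i\<le>degree f. smult (coeff f i) (X i))" by simp_all
  then show ?thesis by (simp add: L.sum L'.sum L.scale L'.scale assms(3))
qed

lemma linear_tensor_left: "Vector_Spaces.linear smult pscale (\<lambda>f. tensor (f :: 'a::field poly) g)"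
  unfolding Vector_Spaces.linear_iff
  by (auto intro!: poly_mapping_eqI vector_space_smult vector_space_pscale
      simp: lookup_add algebra_simps)

lemma linear_tensor_right: "Vector_Spaces.linear smult pscale (\<lambda>g. tensor (f :: 'a::field poly) g)"
  unfolding Vector_Spaces.linear_iff
  by (auto intro!: poly_mapping_eqI vector_space_smult vector_space_pscale
      simp: lookup_add algebra_simps)

lemma linear_tens_left: "Vector_Spaces.linear smult pscale (\<lambda>f. tens_left (f :: 'a::field poly) t)"
  and linear_tens_left': "Vector_Spaces.linear pscale pscale (\<lambda>t. tens_left (f :: 'a::field poly) t)"
  and linear_tens_right: "Vector_Spaces.linear smult pscale (\<lambda>f. tens_right t (f :: 'a::field poly))"
  and linear_tens_right': "Vector_Spaces.linear pscale pscale (\<lambda>t. tens_right t (f :: 'a::field poly))"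
  unfolding Vector_Spaces.linear_iff
  by (auto intro!: poly_mapping_eqI vector_space_smult vector_space_pscale
      simp: lookup_add algebra_simps)

lemmas linear_tensor3 =
  linear_tens_left[where t = "tensor g h" for g h, folded tensor3_def]
  Vector_Spaces.linear_compose[OF linear_tensor_left linear_tens_left', unfolded o_def,
    folded tensor3_def]
  Vector_Spaces.linear_compose[OF linear_tensor_right linear_tens_left', unfolded o_def,
    folded tensor3_def]

theorem tensor_universal:
  fixes s :: "'a::field \<Rightarrow> 'v::ab_group_add \<Rightarrow> 'v" and B :: "'a poly \<Rightarrow> 'a poly \<Rightarrow> 'v"
  assumes lin1: "\<And>g. Vector_Spaces.linear smult s (\<lambda>f. B f g)"
    and lin2: "\<And>f. Vector_Spaces.linear smult s (B f)"
  shows "\<exists>!L. Vector_Spaces.linear pscale s L \<and> (\<forall>f g. L (tensor f g) = B f g)"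
proof (rule ex_ex1I)
  have s: "vector_space s" using lin2[of 0] by (simp add: Vector_Spaces.linear_iff)
  let ?L = "lin_ext s (\<lambda>(i, j). B (X i) (X j))"
  have L: "Vector_Spaces.linear pscale s ?L" by (rule linear_lin_ext[OF s])
  have "?L (tensor f (X j)) = B f (X j)" for f j
    by (rule poly_linear_eqI[OF Vector_Spaces.linear_compose[OF linear_tensor_left L, unfolded o_def] lin1])
       (simp add: tensor_X lin_ext_single[OF s])
  then have "?L (tensor f g) = B f g" for f g
    by (rule poly_linear_eqI[OF Vector_Spaces.linear_compose[OF linear_tensor_right L, unfolded o_def] lin2])
  with L show "\<exists>L. Vector_Spaces.linear pscale s L \<and> (\<forall>f g. L (tensor f g) = B f g)" by blast
next
  fix L L'
  assume "Vector_Spaces.linear pscale s L \<and> (\<forall>f g. L (tensor f g) = B f g)"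
    and "Vector_Spaces.linear pscale s L' \<and> (\<forall>f g. L' (tensor f g) = B f g)"
  then show "L = L'" by (intro pm_linear_eqI[of s]) (auto simp flip: tensor_X)
qed

theorem tensor3_universal:
  fixes s :: "'a::field \<Rightarrow> 'v::ab_group_add \<Rightarrow> 'v" and B :: "'a poly \<Rightarrow> 'a poly \<Rightarrow> 'a poly \<Rightarrow> 'v"
  assumes lin1: "\<And>g h. Vector_Spaces.linear smult s (\<lambda>f. B f g h)"
    and lin2: "\<And>f h. Vector_Spaces.linear smult s (\<lambda>g. B f g h)"
    and lin3: "\<And>f g. Vector_Spaces.linear smult s (B f g)"
  shows "\<exists>!L. Vector_Spaces.linear pscale s L \<and> (\<forall>f g h. L (tensor3 f g h) = B f g h)"
proof (rule ex_ex1I)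
  have s: "vector_space s" using lin3[of 0 0] by (simp add: Vector_Spaces.linear_iff)
  let ?L = "lin_ext s (\<lambda>(i, j, k). B (X i) (X j) (X k))"
  have L: "Vector_Spaces.linear pscale s ?L" by (rule linear_lin_ext[OF s])
  note LT = linear_tensor3[THEN Vector_Spaces.linear_compose[OF _ L], unfolded o_def]
  have "?L (tensor3 f (X j) (X k)) = B f (X j) (X k)" for f j k
    by (rule poly_linear_eqI[OF LT(1) lin1]) (simp add: tensor3_X lin_ext_single[OF s])
  then have "?L (tensor3 f g (X k)) = B f g (X k)" for f g k
    by (rule poly_linear_eqI[OF LT(2) lin2])
  then have "?L (tensor3 f g h) = B f g h" for f g h
    by (rule poly_linear_eqI[OF LT(3) lin3])
  with L show "\<exists>L. Vector_Spaces.linear pscale s L \<and> (\<forall>f g h. L (tensor3 f g h) = B f g h)" by blast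
next
  fix L L'
  assume "Vector_Spaces.linear pscale s L \<and> (\<forall>f g h. L (tensor3 f g h) = B f g h)"
    and "Vector_Spaces.linear pscale s L' \<and> (\<forall>f g h. L' (tensor3 f g h) = B f g h)"
  then show "L = L'" by (intro pm_linear_eqI[of s]) (auto simp flip: tensor3_X)
qed

lemma linear_mult_id: "Vector_Spaces.linear pscale pscale (mult_id :: 'a::field tens3 \<Rightarrow> _)"
  and linear_id_mult: "Vector_Spaces.linear pscale pscale (id_mult :: 'a::field tens3 \<Rightarrow> _)"
  and linear_map_id: "Vector_Spaces.linear pscale pscale (map_id \<phi> :: 'a::field tens3 \<Rightarrow> _)"
  and linear_id_map: "Vector_Spaces.linear pscale pscale (id_map \<phi> :: 'a::field tens3 \<Rightarrow> _)"
  unfolding mult_id_def id_mult_def map_id_def id_map_def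
  by (rule linear_lin_ext[OF vector_space_pscale])+

lemma linear_poly_mult: "Vector_Spaces.linear smult smult ((*) (f :: 'a::field poly))"
  and linear_poly_mult': "Vector_Spaces.linear smult smult (\<lambda>f. f * (g :: 'a::field poly))"
  unfolding Vector_Spaces.linear_iff by (auto simp: algebra_simps vector_space_smult)

lemma mult_id_tensor3: "mult_id (tensor3 f g h) = tensor (f * g) (h :: 'a::field poly)"
proof -
  note LT = linear_tensor3[THEN Vector_Spaces.linear_compose[OF _ linear_mult_id], unfolded o_def]
  have "mult_id (tensor3 f (X j) (X k)) = tensor (f * X j) (X k :: 'a poly)" for f j k
    by (rule poly_linear_eqI[OF LT(1)
          Vector_Spaces.linear_compose[OF linear_poly_mult' linear_tensor_left, unfolded o_def]])
       (simp add: tensor3_X mult_id_def lin_ext_single[OF vector_space_pscale])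
  then have "mult_id (tensor3 f g (X k)) = tensor (f * g) (X k :: 'a poly)" for f g k
    by (rule poly_linear_eqI[OF LT(2)
          Vector_Spaces.linear_compose[OF linear_poly_mult linear_tensor_left, unfolded o_def]])
  then show ?thesis
    by (rule poly_linear_eqI[OF LT(3) linear_tensor_right])
qed

lemma id_mult_tensor3: "id_mult (tensor3 f g h) = tensor f (g * h :: 'a::field poly)"
proof -
  note LT = linear_tensor3[THEN Vector_Spaces.linear_compose[OF _ linear_id_mult], unfolded o_def]
  have "id_mult (tensor3 f (X j) (X k)) = tensor f (X j * X k :: 'a poly)" for f j k
    by (rule poly_linear_eqI[OF LT(1) linear_tensor_left])
       (simp add: tensor3_X id_mult_def lin_ext_single[OF vector_space_pscale])
  then have "id_mult (tensor3 f g (X k)) = tensor f (g * X k :: 'a poly)" for f g k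
    by (rule poly_linear_eqI[OF LT(2)
          Vector_Spaces.linear_compose[OF linear_poly_mult' linear_tensor_right, unfolded o_def]])
  then show ?thesis
    by (rule poly_linear_eqI[OF LT(3)
          Vector_Spaces.linear_compose[OF linear_poly_mult linear_tensor_right, unfolded o_def]])
qed

lemma map_id_tens_right:
  fixes \<phi> :: "'a::field tens2 \<Rightarrow> 'a tens2"
  assumes "Vector_Spaces.linear pscale pscale \<phi>"
  shows "map_id \<phi> (tens_right t h) = tens_right (\<phi> t) h"
proof -
  note lc = Vector_Spaces.linear_compose[unfolded o_def]
  have 1: "tens_right (Poly_Mapping.single p 1) (X k) = Poly_Mapping.single (fst p, snd p, k) (1::'a)" for p k
    by (cases p) (simp flip: tensor_X tensor3_X add: tens_right_tensor)
  have "(\<lambda>t. map_id \<phi> (tens_right t (X k))) = (\<lambda>t. tens_right (\<phi> t) (X k))" for k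
    by (rule pm_linear_eqI[OF lc[OF linear_tens_right' linear_map_id] lc[OF assms linear_tens_right']])
       (simp add: 1 map_id_def lin_ext_single[OF vector_space_pscale] tensor_X)
  then have "map_id \<phi> (tens_right t (X k)) = tens_right (\<phi> t) (X k)" for k
    by metis
  then show ?thesis
    by (rule poly_linear_eqI[OF lc[OF linear_tens_right linear_map_id] linear_tens_right])
qed

lemma id_map_tens_left:
  fixes \<phi> :: "'a::field tens2 \<Rightarrow> 'a tens2"
  assumes "Vector_Spaces.linear pscale pscale \<phi>"
  shows "id_map \<phi> (tens_left f t) = tens_left f (\<phi> t)"
proof -
  note lc = Vector_Spaces.linear_compose[unfolded o_def]
  have 1: "tens_left (X k) (Poly_Mapping.single p 1) = Poly_Mapping.single (k, p) (1::'a)" for p k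
    by (cases p) (simp flip: tensor_X tensor3_X add: tensor3_def)
  have "(\<lambda>t. id_map \<phi> (tens_left (X k) t)) = (\<lambda>t. tens_left (X k) (\<phi> t))" for k
    by (rule pm_linear_eqI[OF lc[OF linear_tens_left' linear_id_map] lc[OF assms linear_tens_left']])
       (auto simp: 1 id_map_def lin_ext_single[OF vector_space_pscale] tensor_X split: prod.splits)
  then have "id_map \<phi> (tens_left (X k) t) = tens_left (X k) (\<phi> t)" for k
    by metis
  then show ?thesis
    by (rule poly_linear_eqI[OF lc[OF linear_tens_left linear_id_map] linear_tens_left])
qed


section \<open>Twisting maps\<close>

text \<open>Arguments of \<^term>\<open>\<tau>\<close> live in \<open>K[y] \<otimes> K[x]\<close>, its values in \<open>K[x] \<otimes> K[y]\<close>.\<close>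

definition twisting_map :: "('a::field tens2 \<Rightarrow> 'a tens2) \<Rightarrow> bool" where
  "twisting_map \<tau> \<longleftrightarrow>
     Vector_Spaces.linear pscale pscale \<tau> \<and>
     (\<forall>f. \<tau> (tensor 1 f) = tensor f 1) \<and>
     (\<forall>r. \<tau> (tensor (X r) 1) = tensor 1 (X r)) \<and>
     \<tau> \<circ> id_mult = mult_id \<circ> id_map \<tau> \<circ> map_id \<tau> \<and>
     \<tau> \<circ> mult_id = id_mult \<circ> map_id \<tau> \<circ> id_map \<tau>"

definition graded :: "('a::field tens2 \<Rightarrow> 'a tens2) \<Rightarrow> bool" where
  "graded \<tau> \<longleftrightarrow>
     (\<forall>r i. \<tau> (tensor (X r) (X i)) \<in>
        module.span pscale {tensor (X (r + i - j)) (X j) | j. j \<le> r + i})"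

text \<open>The correspondence between linear maps \<open>\<tau>\<close> and families \<open>\<gamma> r j\<close> of linear maps, with the
  superscript \<open>r\<close> written first; see \<open>ex1_corresponds_map\<close> and \<open>ex1_corresponds_family\<close>.\<close>

definition locally_finite_family :: "(nat \<Rightarrow> nat \<Rightarrow> 'a::field poly \<Rightarrow> 'a poly) \<Rightarrow> bool" where
  "locally_finite_family \<gamma> \<longleftrightarrow>
     (\<forall>r j. Vector_Spaces.linear smult smult (\<gamma> r j)) \<and>
     (\<forall>r f. finite {j. \<gamma> r j f \<noteq> 0})"

definition corresponds ::
  "(nat \<Rightarrow> nat \<Rightarrow> 'a::field poly \<Rightarrow> 'a poly) \<Rightarrow> ('a tens2 \<Rightarrow> 'a tens2) \<Rightarrow> bool" where
  "corresponds \<gamma> \<tau> \<longleftrightarrow>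
     locally_finite_family \<gamma> \<and>
     Vector_Spaces.linear pscale pscale \<tau> \<and>
     (\<forall>r f. \<tau> (tensor (X r) f) = (\<Sum>j | \<gamma> r j f \<noteq> 0. tensor (\<gamma> r j f) (X j)))"

text \<open>The family of linear maps given by a matrix through
  \<open>\<gamma> r j (x^i) = (M^i) r j * x^(r + i - j)\<close>, read as \<open>0\<close> when \<open>j > r + i\<close>
  (where \<open>(M^i) r j = 0\<close> for the matrices in question, see \<open>twisting_matrix_power_eq_0\<close>).\<close>

definition family_of_matrix ::
  "'a::field rfmat \<Rightarrow> (nat \<Rightarrow> nat \<Rightarrow> 'a poly \<Rightarrow> 'a poly) \<Rightarrow> bool" where
  "family_of_matrix M \<gamma> \<longleftrightarrow>
     (\<forall>r j. Vector_Spaces.linear smult smult (\<gamma> r j)) \<and>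
     (\<forall>r j i. \<gamma> r j (X i) =
        (if j \<le> r + i then smult (entry (M ^ i) r j) (X (r + i - j)) else 0))"

lemma twisting_matrix_power_eq_0:
  assumes "twisting_matrix M" "j > r + i"
  shows "entry (M ^ i) r j = 0"
  using assms(2)
proof (induction i arbitrary: r)
  case 0
  then show ?case by (simp add: one_rfmat.rep_eq)
next
  case (Suc i)
  have "entry M r k * entry (M ^ i) k j = 0" for k
  proof (cases "k > r + 1")
    case True
    then show ?thesis using assms(1) by (simp add: twisting_matrix_def)
  next
    case False
    then show ?thesis using Suc by simp
  qed
  then show ?case by (simp add: times_rfmat.rep_eq)
qed

lemma ex1_poly_linear:
  fixes s :: "'a::field \<Rightarrow> 'v::ab_group_add \<Rightarrow> 'v"
  assumes "vector_space s"
  shows "\<exists>!L. Vector_Spaces.linear smult s L \<and> (\<forall>i. L (X i) = \<phi> i)"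
proof (rule ex_ex1I)
  let ?P = "\<lambda>f. lin_ext s (\<lambda>(i, j). \<phi> i) (tensor f 1)"
  have "Vector_Spaces.linear smult s ?P"
    by (rule Vector_Spaces.linear_compose[OF linear_tensor_left linear_lin_ext[OF assms], unfolded o_def])
  moreover have "?P (X i) = \<phi> i" for i
    using tensor_X[of i 0, where 'a = 'a] by (simp add: lin_ext_single[OF assms])
  ultimately show "\<exists>L. Vector_Spaces.linear smult s L \<and> (\<forall>i. L (X i) = \<phi> i)" by blast
next
  fix L L'
  assume "Vector_Spaces.linear smult s L \<and> (\<forall>i. L (X i) = \<phi> i)"
    "Vector_Spaces.linear smult s L' \<and> (\<forall>i. L' (X i) = \<phi> i)"
  then show "L = L'" by - (rule ext, rule poly_linear_eqI[of s], auto)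
qed

lemma ex1_family_of_matrix: "\<exists>!\<gamma>. family_of_matrix M \<gamma>"
proof -
  let ?Q = "\<lambda>r j L. Vector_Spaces.linear smult smult L \<and> (\<forall>i. L (X i) =
    (if j \<le> r + i then smult (entry (M ^ i) r j) (X (r + i - j)) else 0))"
  have "\<exists>!L. ?Q r j L" for r j
    by (rule ex1_poly_linear[OF vector_space_smult])
  then have ex: "?Q r j (THE L. ?Q r j L)" and un: "?Q r j L \<Longrightarrow> ?Q r j L' \<Longrightarrow> L = L'" for r j L L'
    by (rule theI', blast)
  have eq: "family_of_matrix M \<gamma> \<longleftrightarrow> (\<forall>r j. ?Q r j (\<gamma> r j))" for \<gamma>
    unfolding family_of_matrix_def by blast
  show ?thesis unfolding eq
  proof (rule ex1I[of _ "\<lambda>r j. THE L. ?Q r j L"])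
    show "\<forall>r j. ?Q r j (THE L. ?Q r j L)" using ex by blast
    fix \<gamma> assume g: "\<forall>r j. ?Q r j (\<gamma> r j)"
    show "\<gamma> = (\<lambda>r j. THE L. ?Q r j L)"
    proof (rule ext, rule ext)
      fix r j
      show "\<gamma> r j = (THE L. ?Q r j L)"
        by (rule un[OF spec[OF spec[OF g]] ex])
    qed
  qed
qed

lemma lookup_sum_tensor_X:
  assumes "finite {j. p j \<noteq> 0}"
  shows "Poly_Mapping.lookup (\<Sum>j | p j \<noteq> 0. tensor (p j) (X j)) (i, k) = coeff (p k) i"
proof -
  have "Poly_Mapping.lookup (\<Sum>j | p j \<noteq> 0. tensor (p j) (X j)) (i, k)
      = (\<Sum>j | p j \<noteq> 0. if j = k then coeff (p j) i else 0)"
    by (auto simp: lookup_sum intro!: sum.cong)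
  also have "\<dots> = coeff (p k) i" using assms by (auto simp: sum.delta')
  finally show ?thesis .
qed

lemma ex1_corresponds_map:
  fixes \<gamma> :: "nat \<Rightarrow> nat \<Rightarrow> 'a::field poly \<Rightarrow> 'a poly"
  assumes "locally_finite_family \<gamma>"
  shows "\<exists>!\<tau>. corresponds \<gamma> \<tau>"
proof (rule ex_ex1I)
  have fin: "finite {j. \<gamma> r j f \<noteq> 0}" and g: "Vector_Spaces.linear smult smult (\<gamma> r j)" for r j f
    using assms by (auto simp: locally_finite_family_def)
  let ?G = "\<lambda>r f. \<Sum>j | \<gamma> r j f \<noteq> 0. tensor (\<gamma> r j f) (X j)"
  let ?T = "lin_ext pscale (\<lambda>(r, i). ?G r (X i))"
  have G: "Poly_Mapping.lookup (?G r f) (i, k) = coeff (\<gamma> r k f) i" for r f i k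
    by (rule lookup_sum_tensor_X[OF fin])
  have lG: "Vector_Spaces.linear smult pscale (?G r)" for r
    unfolding Vector_Spaces.linear_iff
  proof (intro conjI allI vector_space_smult vector_space_pscale)
    fix f h :: "'a poly"
    have "\<gamma> r k (f + h) = \<gamma> r k f + \<gamma> r k h" for k
      using g[of r k] by (simp add: Vector_Spaces.linear_iff)
    then have "Poly_Mapping.lookup (?G r (f + h)) (i, k) = Poly_Mapping.lookup (?G r f + ?G r h) (i, k)" for i k
      unfolding G lookup_add by simp
    then show "?G r (f + h) = ?G r f + ?G r h"
      by (metis (no_types, lifting) poly_mapping_eqI surj_pair)
  next
    fix c and f :: "'a poly"
    have "\<gamma> r k (smult c f) = smult c (\<gamma> r k f)" for k
      using g[of r k] by (simp add: Vector_Spaces.linear_iff)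
    then have "Poly_Mapping.lookup (?G r (smult c f)) (i, k) = Poly_Mapping.lookup (pscale c (?G r f)) (i, k)" for i k
      unfolding G lookup_pscale by simp
    then show "?G r (smult c f) = pscale c (?G r f)"
      by (metis (no_types, lifting) poly_mapping_eqI surj_pair)
  qed
  have lT: "Vector_Spaces.linear pscale pscale ?T" by (rule linear_lin_ext[OF vector_space_pscale])
  have "?T (tensor (X r) f) = ?G r f" for r f
    by (rule poly_linear_eqI[OF
          Vector_Spaces.linear_compose[OF linear_tensor_right lT, unfolded o_def] lG])
       (simp add: tensor_X lin_ext_single[OF vector_space_pscale])
  with lT assms have "corresponds \<gamma> ?T" unfolding corresponds_def by blast
  then show "\<exists>\<tau>. corresponds \<gamma> \<tau>" by blast
next
  fix \<tau> \<tau>' assume "corresponds \<gamma> \<tau>" "corresponds \<gamma> \<tau>'"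
  then show "\<tau> = \<tau>'"
    by (intro pm_linear_eqI[of pscale]) (auto simp: corresponds_def simp flip: tensor_X)
qed

lemma ex1_corresponds_family:
  fixes \<tau> :: "'a::field tens2 \<Rightarrow> 'a tens2"
  assumes lt: "Vector_Spaces.linear pscale pscale \<tau>"
  shows "\<exists>!\<gamma>. corresponds \<gamma> \<tau>"
proof (rule ex_ex1I)
  define sl :: "nat \<Rightarrow> 'a tens2 \<Rightarrow> 'a poly" where
    "sl = (\<lambda>j. lin_ext smult (\<lambda>(i, k). if k = j then X i else 0))"
  have lsl: "Vector_Spaces.linear pscale smult (sl j)" for j
    unfolding sl_def by (rule linear_lin_ext[OF vector_space_smult])
  have csl: "coeff (sl j t) i = Poly_Mapping.lookup t (i, j)" for i j t
  proof -
    have "coeff (sl j t) i = (\<Sum>p\<in>Poly_Mapping.keys t. if p = (i, j) then Poly_Mapping.lookup t p else 0)"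
      unfolding sl_def lin_ext_def coeff_sum
      by (rule sum.cong[OF refl]) (auto split: prod.splits)
    then show ?thesis by (auto simp: sum.delta' in_keys_iff)
  qed
  have fsl: "finite {j. sl j t \<noteq> 0}" for t
  proof (rule finite_subset)
    show "{j. sl j t \<noteq> 0} \<subseteq> snd ` Poly_Mapping.keys t"
    proof
      fix j assume "j \<in> {j. sl j t \<noteq> 0}"
      then obtain i where "coeff (sl j t) i \<noteq> 0" by (auto simp: poly_eq_iff)
      then have "(i, j) \<in> Poly_Mapping.keys t" by (simp add: csl in_keys_iff)
      then show "j \<in> snd ` Poly_Mapping.keys t" by force
    qed
  qed simp
  let ?g = "\<lambda>r j f. sl j (\<tau> (tensor (X r) f))"
  have "Vector_Spaces.linear smult smult (?g r j)" for r j
    using Vector_Spaces.linear_compose[OF Vector_Spaces.linear_compose[OF linear_tensor_right lt] lsl]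
    by (simp add: o_def)
  moreover have "t = (\<Sum>j | sl j t \<noteq> 0. tensor (sl j t) (X j))" for t
    by (rule poly_mapping_eqI)
       (use lookup_sum_tensor_X[of "\<lambda>j. sl j t", OF fsl] csl in \<open>auto split: prod.splits\<close>)
  ultimately have "corresponds ?g \<tau>"
    unfolding corresponds_def locally_finite_family_def using fsl lt by blast
  then show "\<exists>\<gamma>. corresponds \<gamma> \<tau>" by (rule exI[of _ ?g])
next
  fix \<gamma> \<gamma>' assume g: "corresponds \<gamma> \<tau>" and g': "corresponds \<gamma>' \<tau>"
  have *: "coeff (\<gamma> r k f) i = Poly_Mapping.lookup (\<tau> (tensor (X r) f)) (i, k)" if "corresponds \<gamma> \<tau>" for \<gamma> r k f i
    using that lookup_sum_tensor_X[of "\<lambda>j. \<gamma> r j f" i k]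
    by (simp add: corresponds_def locally_finite_family_def)
  show "\<gamma> = \<gamma>'" by (intro ext poly_eqI) (simp add: *[OF g] *[OF g'])
qed

end

theory Submission
  imports Defs
begin

text \<open>
  The idea is that a graded linear map is nothing but a sequence of matrices, and that each axiom
  of a twisting map is an equation between them. Gradedness means that
  \<open>\<tau> (y^r \<otimes> x^i)\<close> is a combination of the tensors \<open>x^(r+i-j) \<otimes> y^j\<close>; its coefficients form row
  \<open>r\<close> of a matrix \<open>c i\<close>. Comparing coefficients on tensors of monomials
  (\<open>twisting_map_iff_structure_matrices\<close>), compatibility with the multiplication of \<open>K[x]\<close> becomes
  \<open>c (i + k) = c i * c k\<close>, the axiom \<open>\<tau> (y^r \<otimes> 1) = 1 \<otimes> y^r\<close> becomes \<open>c 0 = 1\<close>, the axiom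
  \<open>\<tau> (1 \<otimes> f) = f \<otimes> 1\<close> prescribes row \<open>0\<close> of all \<open>c i\<close>, and compatibility with the
  multiplication of \<open>K[y]\<close> becomes
  \<open>Y^s * c i = (\<Sum>l\<le>s+i. (c i)\<^sub>s\<^sub>l * c (s+i-l) * Y^l)\<close>.

  The equations \<open>c (i + k) = c i * c k\<close> and \<open>c 0 = 1\<close> say that \<open>c i = M^i\<close> for
  \<open>M = c 1\<close>, and the compatibility with the multiplication of \<open>K[y]\<close>, read at \<open>i = 1\<close>, is then the
  equation demanded of \<open>M\<close>. That equation conversely gives the ones for all \<open>i\<close> by
  induction (\<open>twisting_matrix_power\<close>): it moves one factor \<open>M\<close> past a power of \<open>Y\<close>, and it can be
  applied again to each summand of the result. So graded twisting maps are exactly the graded maps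
  whose matrices are the powers of a single twisting matrix
  (\<open>twisting_map_iff_matrix\<close>), and reading the coefficients through the maps \<open>\<gamma> r j\<close>
  (\<open>family_of_matrix_iff_structure_matrices\<close>) gives both directions of the theorem.
\<close>

section \<open>Entries of products with powers of \<open>Y\<close>\<close>

lemma entry_sum: "entry (sum A S) i j = (\<Sum>k\<in>S. entry (A k) i j)"
  by (induction S rule: infinite_finite_induct) (auto simp: zero_rfmat.rep_eq plus_rfmat.rep_eq)

lemma entry_Y_mat_power_mult: "entry (Y_mat ^ s * A) r j = entry A (r + s) j"
proof (induction s arbitrary: A)
  case (Suc s)
  have Y: "entry (Y_mat * A) q j = entry A (q + 1) j" for q
    by (subst entry_times_superset[of "{q + 1}"]) (auto simp: Y_mat.rep_eq split: if_splits)
  show ?case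
    unfolding power_Suc2 mult.assoc Suc.IH Y by simp
qed simp

lemma entry_Y_mat_power: "entry (Y_mat ^ s) r j = (if r + s = j then 1 else 0)"
  using entry_Y_mat_power_mult[of s 1 r j] by (simp add: one_rfmat.rep_eq)

lemma entry_mult_Y_mat_power:
  "entry (A * Y_mat ^ l) r j = (if l \<le> j then entry A r (j - l) else 0)"
proof -
  let ?S = "insert (j - l) {k. entry A r k \<noteq> 0}"
  have "entry (A * Y_mat ^ l) r j = (\<Sum>k\<in>?S. entry A r k * entry (Y_mat ^ l) k j)"
    by (rule entry_times_superset) (auto simp: finite_row)
  also have "\<dots> = (\<Sum>k\<in>?S. if k = j - l then (if l \<le> j then entry A r (j - l) else 0) else 0)"
    by (rule sum.cong) (auto simp: entry_Y_mat_power)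
  also have "\<dots> = (if l \<le> j then entry A r (j - l) else 0)"
    using finite_row[of A r] by (simp add: sum.delta)
  finally show ?thesis .
qed

lemma mscale_mult_left: "mscale a A * B = mscale a (A * B)"
proof (rule rfmat_eqI)
  fix i j
  have "entry (mscale a A * B) i j = (\<Sum>k | entry A i k \<noteq> 0. entry (mscale a A) i k * entry B k j)"
    by (rule entry_times_superset) (auto simp: finite_row mscale.rep_eq)
  then show "entry (mscale a A * B) i j = entry (mscale a (A * B)) i j"
    by (simp add: mscale.rep_eq times_rfmat.rep_eq sum_distrib_left mult.assoc)
qed

lemma mscale_mult_right: "A * mscale a B = mscale a (A * B)"
  by (rule rfmat_eqI)
     (simp add: mscale.rep_eq times_rfmat.rep_eq sum_distrib_left mult.left_commute)

lemma mscale_mscale: "mscale a (mscale b A) = mscale (a * b) A"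
  by (rule rfmat_eqI) (simp add: mscale.rep_eq mult.assoc)

lemma mscale_sum_right: "mscale a (sum A S) = (\<Sum>k\<in>S. mscale a (A k))"
  by (rule rfmat_eqI) (simp add: mscale.rep_eq entry_sum sum_distrib_left)

lemma mscale_sum_left: "mscale (sum a S) A = (\<Sum>k\<in>S. mscale (a k) A)"
  by (rule rfmat_eqI) (simp add: mscale.rep_eq entry_sum sum_distrib_right)

section \<open>Powers of a twisting matrix\<close>

lemma twisting_matrix_power_row_0:
  assumes "twisting_matrix M"
  shows "entry (M ^ i) 0 j = (if j = 0 then 1 else 0)"
proof (induction i)
  case (Suc i)
  have "entry (M ^ Suc i) 0 j = (\<Sum>k\<in>{0}. entry M 0 k * entry (M ^ i) k j)"
    unfolding power_Suc
    by (rule entry_times_superset) (use assms in \<open>auto simp: twisting_matrix_def split: if_splits\<close>)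
  then show ?case
    using assms Suc by (simp add: twisting_matrix_def)
qed (simp add: one_rfmat.rep_eq)

text \<open>
  In the inductive step, \<open>Y^s * M^i * M\<close> is a sum of terms \<open>M^(s+i-l) * (Y^l * M)\<close>, to which the
  defining equation of a twisting matrix applies for every \<open>l\<close>. The powers of \<open>M\<close> add up to
  \<open>M^(s+i+1-j)\<close>, independently of \<open>l\<close>, so the scalars collect to an entry of \<open>M^i * M\<close>.
\<close>

lemma twisting_matrix_power:
  fixes M :: "'a::comm_ring_1 rfmat"
  assumes zero: "\<And>r i j. j > r + i \<Longrightarrow> entry (M ^ i) r j = 0"
    and eq: "\<And>k. Y_mat ^ k * M = (\<Sum>j\<le>k + 1. mscale (entry M k j) (M ^ (k + 1 - j) * Y_mat ^ j))"
  shows "Y_mat ^ s * M ^ i = (\<Sum>l\<le>s + i. mscale (entry (M ^ i) s l) (M ^ (s + i - l) * Y_mat ^ l))"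
proof (induction i)
  case 0
  have "(\<Sum>l\<le>s. mscale (entry 1 s l) (M ^ (s - l) * Y_mat ^ l))
      = (\<Sum>l\<le>s. if l = s then Y_mat ^ s else 0)"
    by (rule sum.cong) (auto intro!: rfmat_eqI simp: one_rfmat.rep_eq mscale.rep_eq zero_rfmat.rep_eq)
  then show ?case by simp
next
  case (Suc i)
  let ?N = "s + Suc i"
  let ?m = "\<lambda>l j. mscale (entry (M ^ i) s l * entry M l j) (M ^ (?N - j) * Y_mat ^ j)"
  have "Y_mat ^ s * M ^ Suc i = (Y_mat ^ s * M ^ i) * M"
    by (simp add: power_Suc2 mult.assoc del: power_Suc)
  also have "\<dots> = (\<Sum>l\<le>s + i. mscale (entry (M ^ i) s l) (M ^ (s + i - l) * (Y_mat ^ l * M)))"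
    unfolding Suc.IH by (simp add: sum_distrib_right mscale_mult_left mult.assoc)
  also have "\<dots> = (\<Sum>l\<le>s + i. \<Sum>j\<le>?N. ?m l j)"
  proof (rule sum.cong[OF refl])
    fix l assume "l \<in> {..s + i}"
    then have l: "l \<le> s + i" by simp
    have "mscale (entry (M ^ i) s l) (M ^ (s + i - l) * (Y_mat ^ l * M))
        = (\<Sum>j\<le>l + 1. mscale (entry (M ^ i) s l * entry M l j)
            (M ^ (s + i - l) * M ^ (l + 1 - j) * Y_mat ^ j))"
      unfolding eq
      by (simp add: sum_distrib_left mscale_sum_right mscale_mult_right mscale_mscale mult.assoc
          del: sum.atMost_Suc)
    also have "\<dots> = (\<Sum>j\<le>l + 1. ?m l j)"
      using l by (intro sum.cong) (auto simp flip: power_add)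
    also have "\<dots> = (\<Sum>j\<le>?N. ?m l j)"
    proof (rule sum.mono_neutral_left)
      show "\<forall>j\<in>{..?N} - {..l + 1}. ?m l j = 0"
        using zero[of l 1] by (auto intro!: rfmat_eqI simp: mscale.rep_eq zero_rfmat.rep_eq)
    qed (use l in auto)
    finally show "mscale (entry (M ^ i) s l) (M ^ (s + i - l) * (Y_mat ^ l * M)) = (\<Sum>j\<le>?N. ?m l j)" .
  qed
  also have "\<dots> = (\<Sum>j\<le>?N. \<Sum>l\<le>s + i. ?m l j)"
    by (rule sum.swap)
  also have "\<dots> = (\<Sum>j\<le>?N. mscale (entry (M ^ Suc i) s j) (M ^ (?N - j) * Y_mat ^ j))"
  proof (rule sum.cong[OF refl])
    fix j
    have "entry (M ^ i * M) s j = (\<Sum>l\<le>s + i. entry (M ^ i) s l * entry M l j)"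
      by (rule entry_times_superset) (use zero[of s i] in \<open>auto simp: not_le[symmetric]\<close>)
    then show "(\<Sum>l\<le>s + i. ?m l j) = mscale (entry (M ^ Suc i) s j) (M ^ (?N - j) * Y_mat ^ j)"
      by (simp add: power_Suc2 mscale_sum_left del: power_Suc)
  qed
  finally show ?case .
qed

section \<open>Homogeneous tensors\<close>

definition homogeneous :: "nat \<Rightarrow> (nat \<Rightarrow> 'a) \<Rightarrow> 'a::comm_ring_1 tens2" where
  "homogeneous n d = (\<Sum>j\<le>n. pscale (d j) (tensor (X (n - j)) (X j)))"

lemma lookup_homogeneous [simp]:
  "Poly_Mapping.lookup (homogeneous n d) (p, q) = (if p + q = n then d q else 0)"
proof -
  have "Poly_Mapping.lookup (homogeneous n d) (p, q)
      = (\<Sum>j\<le>n. if j = q then (if p + q = n then d q else 0) else 0)"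
    unfolding homogeneous_def lookup_sum by (rule sum.cong) auto
  then show ?thesis by auto
qed

lemma homogeneous_eq_iff: "homogeneous n d = homogeneous n e \<longleftrightarrow> (\<forall>j\<le>n. d j = e j)"
proof
  assume *: "homogeneous n d = homogeneous n e"
  show "\<forall>j\<le>n. d j = e j"
  proof (intro allI impI)
    fix j assume "j \<le> n"
    then show "d j = e j"
      using arg_cong[OF *, of "\<lambda>t. Poly_Mapping.lookup t (n - j, j)"] by simp
  qed
qed (simp add: homogeneous_def)

lemma tensor_X_eq_homogeneous:
  "tensor (X p) (X q) = homogeneous (p + q) (\<lambda>j. if j = q then 1 else 0)"
  by (rule poly_mapping_eqI) auto

lemma sum_pscale_homogeneous:
  "(\<Sum>l\<in>S. pscale (a l) (homogeneous n (d l))) = homogeneous n (\<lambda>j. \<Sum>l\<in>S. a l * d l j)"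
  by (rule poly_mapping_eqI) (auto simp: lookup_sum)

lemma span_monomials_iff_homogeneous:
  "t \<in> module.span pscale {tensor (X (n - j)) (X j) | j. j \<le> n} \<longleftrightarrow>
    (\<exists>d :: nat \<Rightarrow> 'a::field. t = homogeneous n d)"
proof -
  interpret vector_space "pscale :: 'a \<Rightarrow> 'a tens2 \<Rightarrow> 'a tens2" by (rule vector_space_pscale)
  let ?B = "{tensor (X (n - j)) (X j) | j. j \<le> n} :: 'a tens2 set"
  have "span ?B \<subseteq> range (homogeneous n)"
  proof (rule span_minimal)
    show "?B \<subseteq> range (homogeneous n)"
      by (auto simp: tensor_X_eq_homogeneous)
    show "subspace (range (homogeneous n :: _ \<Rightarrow> 'a tens2))"
      unfolding subspace_def
    proof (intro conjI ballI allI)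
      have "0 = homogeneous n (\<lambda>_. 0 :: 'a)"
        by (rule poly_mapping_eqI) auto
      then show "0 \<in> range (homogeneous n :: _ \<Rightarrow> 'a tens2)" by blast
    next
      fix t u :: "'a tens2" assume "t \<in> range (homogeneous n)" "u \<in> range (homogeneous n)"
      then obtain d e where "t = homogeneous n d" "u = homogeneous n e" by blast
      then have "t + u = homogeneous n (\<lambda>j. d j + e j)"
        by (intro poly_mapping_eqI) (auto simp: lookup_add)
      then show "t + u \<in> range (homogeneous n)" by blast
    next
      fix a and t :: "'a tens2" assume "t \<in> range (homogeneous n)"
      then obtain d where "t = homogeneous n d" by blast
      then have "pscale a t = homogeneous n (\<lambda>j. a * d j)"
        by (intro poly_mapping_eqI) auto
      then show "pscale a t \<in> range (homogeneous n)" by blast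
    qed
  qed
  moreover have "homogeneous n d \<in> span ?B" for d
    unfolding homogeneous_def by (intro span_sum span_scale span_base) auto
  ultimately show ?thesis by blast
qed

section \<open>Graded maps as sequences of matrices\<close>

text \<open>
  Row \<open>r\<close> of \<open>c i\<close> lists the coefficients of \<open>\<tau> (y^r \<otimes> x^i)\<close>. Entries beyond the degree \<open>r + i\<close>
  do not occur in \<open>\<tau>\<close>; requiring them to vanish makes \<open>c\<close> unique and turns composition into
  multiplication of matrices.
\<close>

definition structure_matrices :: "('a::field tens2 \<Rightarrow> 'a tens2) \<Rightarrow> (nat \<Rightarrow> 'a rfmat) \<Rightarrow> bool" where
  "structure_matrices \<tau> c \<longleftrightarrow>
     (\<forall>r i. \<tau> (tensor (X r) (X i)) = homogeneous (r + i) (entry (c i) r)) \<and>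
     (\<forall>r i j. j > r + i \<longrightarrow> entry (c i) r j = 0)"

lemma graded_iff_structure_matrices: "graded \<tau> \<longleftrightarrow> (\<exists>c. structure_matrices \<tau> c)"
proof
  assume "graded \<tau>"
  then have "\<forall>r i. \<exists>d. \<tau> (tensor (X r) (X i)) = homogeneous (r + i) d"
    by (simp add: graded_def span_monomials_iff_homogeneous)
  then obtain d where d: "\<And>r i. \<tau> (tensor (X r) (X i)) = homogeneous (r + i) (d r i)"
    by metis
  define c where "c i = Rfmat (\<lambda>r j. if j \<le> r + i then d r i j else 0)" for i
  have "entry (c i) r j = (if j \<le> r + i then d r i j else 0)" for i r j
    unfolding c_def by (subst Rfmat_inverse) (auto intro: finite_subset[of _ "{..n}" for n])
  with d have "structure_matrices \<tau> c"
    by (simp add: structure_matrices_def homogeneous_eq_iff)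
  then show "\<exists>c. structure_matrices \<tau> c" by blast
qed (auto simp: structure_matrices_def graded_def span_monomials_iff_homogeneous)

lemma tensor3_linear_eq_iff:
  fixes L L' :: "'a::field tens3 \<Rightarrow> 'v::ab_group_add"
  assumes "Vector_Spaces.linear pscale s L" "Vector_Spaces.linear pscale s L'"
  shows "L = L' \<longleftrightarrow> (\<forall>i j k. L (tensor3 (X i) (X j) (X k)) = L' (tensor3 (X i) (X j) (X k)))"
  using pm_linear_eqI[OF assms] by (auto simp: tensor3_X)

lemma linear_homogeneous:
  assumes "Vector_Spaces.linear pscale s L"
  shows "L (homogeneous n d) = (\<Sum>j\<le>n. s (d j) (L (tensor (X (n - j)) (X j))))"
proof -
  interpret Vector_Spaces.linear pscale s L by fact
  show ?thesis by (simp add: homogeneous_def sum scale)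
qed

text \<open>
  Multiplying \<open>x^a\<close> with the first factor leaves the exponents of \<open>y\<close> alone, hence the coefficients
  as well; multiplying the second factor with \<open>y^l\<close> shifts them, which is what right
  multiplication by \<open>Y^l\<close> does to a row of a matrix.
\<close>

lemma mult_id_tens_left_homogeneous:
  fixes d :: "nat \<Rightarrow> 'a::field"
  assumes "\<And>j. j > n \<Longrightarrow> d j = 0"
  shows "mult_id (tens_left (X a) (homogeneous n d)) = homogeneous (a + n) d"
proof -
  note lin = Vector_Spaces.linear_compose[OF linear_tens_left' linear_mult_id, unfolded o_def]
  have "mult_id (tens_left (X a) (homogeneous n d))
      = (\<Sum>j\<le>n. pscale (d j) (tensor (X (a + (n - j))) (X j)))"
    by (simp add: linear_homogeneous[OF lin] mult_id_tensor3 mult_monom flip: tensor3_def)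
  also have "\<dots> = (\<Sum>j\<le>n. pscale (d j) (tensor (X (a + n - j)) (X j)))"
    by (rule sum.cong) auto
  also have "\<dots> = homogeneous (a + n) d"
    unfolding homogeneous_def
    by (rule sum.mono_neutral_left) (auto intro!: poly_mapping_eqI simp: assms)
  finally show ?thesis .
qed

lemma id_mult_tens_right_homogeneous:
  fixes A :: "'a::field rfmat"
  shows "id_mult (tens_right (homogeneous n (entry A r)) (X l)) = homogeneous (n + l) (entry (A * Y_mat ^ l) r)"
proof -
  note lin = Vector_Spaces.linear_compose[OF linear_tens_right' linear_id_mult, unfolded o_def]
  have "id_mult (tens_right (homogeneous n (entry A r)) (X l))
      = (\<Sum>j\<le>n. pscale (entry A r j) (tensor (X (n - j)) (X (j + l))))"
    by (simp add: linear_homogeneous[OF lin] tens_right_tensor id_mult_tensor3 mult_monom)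
  also have "\<dots> = (\<Sum>j\<le>n. pscale (entry (A * Y_mat ^ l) r (j + l))
      (tensor (X (n + l - (j + l))) (X (j + l))))"
    by (simp add: entry_mult_Y_mat_power)
  also have "\<dots> = (\<Sum>j\<in>{l..n + l}. pscale (entry (A * Y_mat ^ l) r j) (tensor (X (n + l - j)) (X j)))"
    by (rule sum.reindex_bij_witness[of _ "\<lambda>j. j - l" "\<lambda>j. j + l"]) auto
  also have "\<dots> = homogeneous (n + l) (entry (A * Y_mat ^ l) r)"
    unfolding homogeneous_def
    by (rule sum.mono_neutral_left)
       (auto intro!: poly_mapping_eqI simp: entry_mult_Y_mat_power)
  finally show ?thesis .
qed

text \<open>
  On \<open>y^r \<otimes> x^i \<otimes> x^k\<close>, the first application of \<open>\<tau>\<close> uses row \<open>r\<close> of \<open>c i\<close> to produce the powers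
  \<open>y^l\<close>, and the second one uses row \<open>l\<close> of \<open>c k\<close>: this is a product of matrices.
\<close>

lemma twist_x_product:
  assumes lin: "Vector_Spaces.linear pscale pscale \<tau>" and str: "structure_matrices \<tau> c"
  shows "mult_id (id_map \<tau> (map_id \<tau> (tensor3 (X r) (X i) (X k))))
    = homogeneous (r + i + k) (entry (c i * c k) r)"
proof -
  have val: "\<tau> (tensor (X r) (X i)) = homogeneous (r + i) (entry (c i) r)"
    and zero: "j > r + i \<Longrightarrow> entry (c i) r j = 0" for r i j
    using str by (auto simp: structure_matrices_def)
  note lc = Vector_Spaces.linear_compose[unfolded o_def]
  note outer = lc[OF lc[OF linear_tens_right' linear_id_map] linear_mult_id]
  have "mult_id (id_map \<tau> (map_id \<tau> (tensor3 (X r) (X i) (X k))))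
      = mult_id (id_map \<tau> (tens_right (homogeneous (r + i) (entry (c i) r)) (X k)))"
    by (simp add: map_id_tens_right[OF lin] val flip: tens_right_tensor)
  also have "\<dots> = (\<Sum>l\<le>r + i. pscale (entry (c i) r l)
      (mult_id (tens_left (X (r + i - l)) (homogeneous (l + k) (entry (c k) l)))))"
    by (simp add: linear_homogeneous[OF outer] tens_right_tensor)
       (simp add: tensor3_def id_map_tens_left[OF lin] val)
  also have "\<dots> = (\<Sum>l\<le>r + i. pscale (entry (c i) r l) (homogeneous (r + i + k) (entry (c k) l)))"
  proof (rule sum.cong[OF refl])
    fix l assume "l \<in> {..r + i}"
    then have "r + i - l + (l + k) = r + i + k" by simp
    moreover have "mult_id (tens_left (X (r + i - l)) (homogeneous (l + k) (entry (c k) l)))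
        = homogeneous (r + i - l + (l + k)) (entry (c k) l)"
      by (rule mult_id_tens_left_homogeneous) (rule zero)
    ultimately show "pscale (entry (c i) r l)
        (mult_id (tens_left (X (r + i - l)) (homogeneous (l + k) (entry (c k) l))))
      = pscale (entry (c i) r l) (homogeneous (r + i + k) (entry (c k) l))" by (simp only:)
  qed
  also have "\<dots> = homogeneous (r + i + k) (\<lambda>j. \<Sum>l\<le>r + i. entry (c i) r l * entry (c k) l j)"
    by (rule sum_pscale_homogeneous)
  also have "(\<lambda>j. \<Sum>l\<le>r + i. entry (c i) r l * entry (c k) l j) = entry (c i * c k) r"
    by (intro ext entry_times_superset[symmetric]) (use zero[of r i] in \<open>auto simp: not_le[symmetric]\<close>)
  finally show ?thesis .
qed

text \<open>
  On \<open>y^r \<otimes> y^s \<otimes> x^i\<close>, the first application of \<open>\<tau>\<close> produces the tensors \<open>x^(s+i-l) \<otimes> y^l\<close>, so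
  the second one meets a power of \<open>x\<close> that depends on \<open>l\<close>: this is why different matrices \<open>c\<close>
  appear in the sum.
\<close>

lemma twist_y_product:
  assumes lin: "Vector_Spaces.linear pscale pscale \<tau>" and str: "structure_matrices \<tau> c"
  shows "id_mult (map_id \<tau> (id_map \<tau> (tensor3 (X r) (X s) (X i))))
    = homogeneous (r + s + i)
        (entry (\<Sum>l\<le>s + i. mscale (entry (c i) s l) (c (s + i - l) * Y_mat ^ l)) r)"
proof -
  have val: "\<tau> (tensor (X r) (X i)) = homogeneous (r + i) (entry (c i) r)" for r i
    using str by (auto simp: structure_matrices_def)
  note lc = Vector_Spaces.linear_compose[unfolded o_def]
  note outer = lc[OF lc[OF linear_tens_left' linear_map_id] linear_id_mult]
  have "id_mult (map_id \<tau> (id_map \<tau> (tensor3 (X r) (X s) (X i))))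
      = id_mult (map_id \<tau> (tens_left (X r) (homogeneous (s + i) (entry (c i) s))))"
    by (simp add: tensor3_def id_map_tens_left[OF lin] val)
  also have "\<dots> = (\<Sum>l\<le>s + i. pscale (entry (c i) s l)
      (id_mult (tens_right (homogeneous (r + (s + i - l)) (entry (c (s + i - l)) r)) (X l))))"
    by (simp add: linear_homogeneous[OF outer] flip: tensor3_def)
       (simp add: map_id_tens_right[OF lin] val flip: tens_right_tensor)
  also have "\<dots> = (\<Sum>l\<le>s + i. pscale (entry (c i) s l)
      (homogeneous (r + s + i) (entry (c (s + i - l) * Y_mat ^ l) r)))"
    by (rule sum.cong) (auto simp: id_mult_tens_right_homogeneous add.assoc)
  also have "\<dots> = homogeneous (r + s + i)
      (\<lambda>j. \<Sum>l\<le>s + i. entry (c i) s l * entry (c (s + i - l) * Y_mat ^ l) r j)"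
    by (rule sum_pscale_homogeneous)
  finally show ?thesis
    unfolding entry_sum[abs_def] mscale.rep_eq .
qed

lemma twisting_map_iff_structure_matrices:
  fixes \<tau> :: "'a::field tens2 \<Rightarrow> 'a tens2"
  assumes lin: "Vector_Spaces.linear pscale pscale \<tau>" and str: "structure_matrices \<tau> c"
  shows "twisting_map \<tau> \<longleftrightarrow>
    (\<forall>i j. entry (c i) 0 j = (if j = 0 then 1 else 0)) \<and>
    c 0 = 1 \<and>
    (\<forall>i k. c (i + k) = c i * c k) \<and>
    (\<forall>s i. Y_mat ^ s * c i = (\<Sum>l\<le>s + i. mscale (entry (c i) s l) (c (s + i - l) * Y_mat ^ l)))"
proof -
  have val: "\<tau> (tensor (X r) (X i)) = homogeneous (r + i) (entry (c i) r)"
    and zero: "j > r + i \<Longrightarrow> entry (c i) r j = 0" for r i j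
    using str by (auto simp: structure_matrices_def)
  note lc = Vector_Spaces.linear_compose[unfolded o_def]
  \<comment> \<open>Tensors of degree \<open>n\<close> only determine coefficients up to \<open>n\<close>; the remaining entries agree
    because they vanish.\<close>
  have row_eq: "homogeneous n d = homogeneous n e \<longleftrightarrow> d = e"
    if "\<And>j. j > n \<Longrightarrow> d j = 0" "\<And>j. j > n \<Longrightarrow> e j = 0" for n and d e :: "nat \<Rightarrow> 'a"
    using that by (auto simp: homogeneous_eq_iff fun_eq_iff) (metis not_le)
  have mat_eq: "A = B \<longleftrightarrow> (\<forall>r. entry A r = entry B r)" for A B :: "'a rfmat"
    by (auto intro: rfmat_eqI)

  have "(\<forall>f. \<tau> (tensor 1 f) = tensor f 1) \<longleftrightarrow> (\<forall>i. \<tau> (tensor (X 0) (X i)) = tensor (X i) (X 0))"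
    using poly_linear_eqI[OF lc[OF linear_tensor_right lin] linear_tensor_left, of 1 1] by auto
  also have "\<dots> \<longleftrightarrow> (\<forall>i. entry (c i) 0 = (\<lambda>j. if j = 0 then 1 else 0))"
    unfolding val unfolding tensor_X_eq_homogeneous using zero[of 0] by (auto simp: row_eq)
  finally have unit_x: "(\<forall>f. \<tau> (tensor 1 f) = tensor f 1) \<longleftrightarrow>
      (\<forall>i j. entry (c i) 0 j = (if j = 0 then 1 else 0))"
    by (simp add: fun_eq_iff)

  have "(\<forall>r. \<tau> (tensor (X r) 1) = tensor 1 (X r)) \<longleftrightarrow>
      (\<forall>r. \<tau> (tensor (X r) (X 0)) = tensor (X 0) (X r))"
    by simp
  also have "\<dots> \<longleftrightarrow> (\<forall>r. entry (c 0) r = entry 1 r)"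
    unfolding val unfolding tensor_X_eq_homogeneous using zero[of _ 0]
    by (auto simp: row_eq one_rfmat.rep_eq fun_eq_iff)
  finally have unit_y: "(\<forall>r. \<tau> (tensor (X r) 1) = tensor 1 (X r)) \<longleftrightarrow> c 0 = 1"
    by (simp add: mat_eq)

  have "\<tau> \<circ> id_mult = mult_id \<circ> id_map \<tau> \<circ> map_id \<tau> \<longleftrightarrow>
      (\<forall>r i k. homogeneous (r + i + k) (entry (c (i + k)) r)
        = homogeneous (r + i + k) (entry (c i * c k) r))"
    unfolding comp_assoc
    by (subst tensor3_linear_eq_iff[of pscale])
       (auto simp: twist_x_product[OF lin str] id_mult_tensor3 mult_monom val add.assoc
         intro!: Vector_Spaces.linear_compose linear_id_mult linear_mult_id linear_id_map
           linear_map_id lin)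
  also have "\<dots> \<longleftrightarrow> (\<forall>r i k. entry (c (i + k)) r = entry (c i * c k) r)"
  proof -
    have "entry (c i * c k) r j = 0" if "j > r + i + k" for r i k j
    proof -
      have "entry (c i) r l * entry (c k) l j = 0" for l
        using that zero[of r i l] zero[of l k j] by (cases "l > r + i") auto
      then show ?thesis unfolding times_rfmat.rep_eq by (intro sum.neutral) blast
    qed
    with zero show ?thesis by (subst row_eq) (auto simp: add.assoc)
  qed
  finally have mult_x: "\<tau> \<circ> id_mult = mult_id \<circ> id_map \<tau> \<circ> map_id \<tau> \<longleftrightarrow>
      (\<forall>i k. c (i + k) = c i * c k)"
    by (auto simp: mat_eq)

  let ?S = "\<lambda>s i. \<Sum>l\<le>s + i. mscale (entry (c i) s l) (c (s + i - l) * Y_mat ^ l)"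
  have "\<tau> \<circ> mult_id = id_mult \<circ> map_id \<tau> \<circ> id_map \<tau> \<longleftrightarrow>
      (\<forall>r s i. homogeneous (r + s + i) (entry (Y_mat ^ s * c i) r)
        = homogeneous (r + s + i) (entry (?S s i) r))"
    unfolding comp_assoc
    by (subst tensor3_linear_eq_iff[of pscale])
       (auto simp: twist_y_product[OF lin str] mult_id_tensor3 mult_monom val
           entry_Y_mat_power_mult homogeneous_eq_iff
         intro!: Vector_Spaces.linear_compose linear_id_mult linear_mult_id linear_id_map
           linear_map_id lin)
  also have "\<dots> \<longleftrightarrow> (\<forall>r s i. entry (Y_mat ^ s * c i) r = entry (?S s i) r)"
  proof -
    have "entry (?S s i) r j = 0" if "j > r + s + i" for r s i j
      using that by (auto simp: entry_sum mscale.rep_eq entry_mult_Y_mat_power zero intro!: sum.neutral)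
    with zero show ?thesis by (subst row_eq) (auto simp: entry_Y_mat_power_mult)
  qed
  finally have mult_y: "\<tau> \<circ> mult_id = id_mult \<circ> map_id \<tau> \<circ> id_map \<tau> \<longleftrightarrow>
      (\<forall>s i. Y_mat ^ s * c i = ?S s i)"
    by (auto simp: mat_eq)

  show ?thesis
    unfolding twisting_map_def unit_x unit_y mult_x mult_y using lin by simp
qed

theorem twisting_map_iff_matrix:
  fixes \<tau> :: "'a::field tens2 \<Rightarrow> 'a tens2"
  assumes lin: "Vector_Spaces.linear pscale pscale \<tau>" and str: "structure_matrices \<tau> c"
  shows "twisting_map \<tau> \<longleftrightarrow> (\<exists>M. twisting_matrix M \<and> c = (\<lambda>i. M ^ i))"
proof
  assume "twisting_map \<tau>"
  then have row: "\<And>i j. entry (c i) 0 j = (if j = 0 then 1 else 0)" and c0: "c 0 = 1"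
    and mult: "\<And>i k. c (i + k) = c i * c k"
    and eq: "\<And>s i. Y_mat ^ s * c i = (\<Sum>l\<le>s + i. mscale (entry (c i) s l) (c (s + i - l) * Y_mat ^ l))"
    unfolding twisting_map_iff_structure_matrices[OF lin str] by blast+
  have pow: "c i = c 1 ^ i" for i
  proof (induction i)
    case (Suc i)
    then show ?case using mult[of 1 i] by simp
  qed (simp add: c0)
  have "twisting_matrix (c 1)"
    unfolding twisting_matrix_def atLeast0AtMost
  proof (intro conjI allI)
    show "Y_mat ^ k * c 1 = (\<Sum>j\<le>k + 1. mscale (entry (c 1) k j) (c 1 ^ (k + 1 - j) * Y_mat ^ j))" for k
      using eq[of k 1] unfolding pow[symmetric] .
  qed (use row str in \<open>auto simp: structure_matrices_def\<close>)
  with pow show "\<exists>M. twisting_matrix M \<and> c = (\<lambda>i. M ^ i)" by blast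
next
  assume "\<exists>M. twisting_matrix M \<and> c = (\<lambda>i. M ^ i)"
  then obtain M where M: "twisting_matrix M" and c: "c = (\<lambda>i. M ^ i)" by blast
  have "Y_mat ^ s * M ^ i = (\<Sum>l\<le>s + i. mscale (entry (M ^ i) s l) (M ^ (s + i - l) * Y_mat ^ l))" for s i
    by (rule twisting_matrix_power[OF twisting_matrix_power_eq_0[OF M]])
       (use M in \<open>auto simp: twisting_matrix_def atLeast0AtMost\<close>)
  then show "twisting_map \<tau>"
    unfolding twisting_map_iff_structure_matrices[OF lin str] c
    using twisting_matrix_power_row_0[OF M] by (simp add: power_add)
qed

section \<open>Reading the matrices off the family\<close>

lemma coeff_corresponds:
  assumes "corresponds \<gamma> \<tau>"
  shows "coeff (\<gamma> r k f) p = Poly_Mapping.lookup (\<tau> (tensor (X r) f)) (p, k)"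
  using assms lookup_sum_tensor_X[of "\<lambda>j. \<gamma> r j f" p k]
  by (simp add: corresponds_def locally_finite_family_def)

lemma family_of_matrix_iff_structure_matrices:
  assumes cor: "corresponds \<gamma> \<tau>" and M: "twisting_matrix M"
  shows "family_of_matrix M \<gamma> \<longleftrightarrow> structure_matrices \<tau> (\<lambda>i. M ^ i)"
proof -
  have "\<gamma> r j (X i) = (if j \<le> r + i then smult (entry (M ^ i) r j) (X (r + i - j)) else 0) \<longleftrightarrow>
      (\<forall>p. Poly_Mapping.lookup (\<tau> (tensor (X r) (X i))) (p, j)
        = Poly_Mapping.lookup (homogeneous (r + i) (entry (M ^ i) r)) (p, j))" for r j i
  proof -
    have "coeff (if j \<le> r + i then smult (entry (M ^ i) r j) (X (r + i - j)) else 0) p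
        = Poly_Mapping.lookup (homogeneous (r + i) (entry (M ^ i) r)) (p, j)" for p
      by auto
    then show ?thesis
      by (simp only: poly_eq_iff coeff_corresponds[OF cor])
  qed
  moreover have "Vector_Spaces.linear smult smult (\<gamma> r j)" for r j
    using cor by (simp add: corresponds_def locally_finite_family_def)
  ultimately show ?thesis
    using twisting_matrix_power_eq_0[OF M]
    by (simp add: family_of_matrix_def structure_matrices_def poly_mapping_eq_iff fun_eq_iff
        del: lookup_homogeneous) blast
qed

lemma locally_finite_family_of_matrix:
  assumes "family_of_matrix M \<gamma>"
  shows "locally_finite_family \<gamma>"
  unfolding locally_finite_family_def
proof (intro conjI allI)
  show lin: "Vector_Spaces.linear smult smult (\<gamma> r j)" for r j
    using assms by (simp add: family_of_matrix_def)
  fix r and f :: "'a poly"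
  have "\<gamma> r j f = 0" if "j > r + degree f" for j
  proof -
    interpret Vector_Spaces.linear smult smult "\<gamma> r j" by (rule lin)
    have "\<gamma> r j f = \<gamma> r j (\<Sum>i\<le>degree f. smult (coeff f i) (X i))"
      by (simp add: smult_monom poly_as_sum_of_monoms)
    also have "\<dots> = (\<Sum>i\<le>degree f. smult (coeff f i) (\<gamma> r j (X i)))"
      by (simp only: sum scale)
    also have "\<dots> = 0"
      using assms that by (intro sum.neutral) (auto simp: family_of_matrix_def)
    finally show ?thesis .
  qed
  then have "{j. \<gamma> r j f \<noteq> 0} \<subseteq> {..r + degree f}"
    by (metis (mono_tags, lifting) atMost_iff leI mem_Collect_eq subsetI)
  then show "finite {j. \<gamma> r j f \<noteq> 0}"
    by (rule finite_subset) simp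
qed

lemma twisting_matrix_of_family_unique:
  assumes M: "twisting_matrix M" "family_of_matrix M \<gamma>"
    and N: "twisting_matrix N" "family_of_matrix N \<gamma>"
  shows "M = N"
proof (rule rfmat_eqI)
  fix r j
  show "entry M r j = entry N r j"
  proof (cases "j \<le> r + 1")
    case True
    have "smult (entry A r j) (X (r + 1 - j)) = \<gamma> r j (X 1)" if "family_of_matrix A \<gamma>" for A
      using that True by (simp add: family_of_matrix_def del: One_nat_def)
    from this[OF M(2)] this[OF N(2)] show ?thesis
      by (metis coeff_monom smult_monom mult.right_neutral)
  next
    case False
    with M(1) N(1) show ?thesis by (simp add: twisting_matrix_def)
  qed
qed

theorem corollary1p8:
  shows "(\<forall>(M :: 'a::field rfmat) \<gamma>. twisting_matrix M \<and> family_of_matrix M \<gamma> \<longrightarrow>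
            (\<exists>!\<tau>. corresponds \<gamma> \<tau> \<and> twisting_map \<tau> \<and> graded \<tau>)) \<and>
         (\<forall>(\<tau> :: 'a tens2 \<Rightarrow> 'a tens2) \<gamma>. twisting_map \<tau> \<and> graded \<tau> \<and> corresponds \<gamma> \<tau> \<longrightarrow>
            (\<exists>!M. family_of_matrix M \<gamma> \<and> twisting_matrix M))"
proof (intro conjI allI impI; elim conjE)
  fix M :: "'a rfmat" and \<gamma>
  assume M: "twisting_matrix M" and fam: "family_of_matrix M \<gamma>"
  have ex1: "\<exists>!\<tau>. corresponds \<gamma> \<tau>"
    by (rule ex1_corresponds_map[OF locally_finite_family_of_matrix[OF fam]])
  then obtain \<tau> where cor: "corresponds \<gamma> \<tau>" by blast
  then have lin: "Vector_Spaces.linear pscale pscale \<tau>"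
    by (simp add: corresponds_def)
  have str: "structure_matrices \<tau> (\<lambda>i. M ^ i)"
    using family_of_matrix_iff_structure_matrices[OF cor M] fam by simp
  then have "graded \<tau>"
    using graded_iff_structure_matrices by blast
  moreover have "twisting_map \<tau>"
    using twisting_map_iff_matrix[OF lin str] M by blast
  ultimately show "\<exists>!\<tau>. corresponds \<gamma> \<tau> \<and> twisting_map \<tau> \<and> graded \<tau>"
    using ex1 cor by blast
next
  fix \<tau> :: "'a tens2 \<Rightarrow> 'a tens2" and \<gamma>
  assume tw: "twisting_map \<tau>" and "graded \<tau>" and cor: "corresponds \<gamma> \<tau>"
  have lin: "Vector_Spaces.linear pscale pscale \<tau>"
    using cor by (simp add: corresponds_def)
  from \<open>graded \<tau>\<close> obtain c where str: "structure_matrices \<tau> c"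
    using graded_iff_structure_matrices by blast
  with tw obtain M where M: "twisting_matrix M" and "c = (\<lambda>i. M ^ i)"
    using twisting_map_iff_matrix[OF lin str] by blast
  then have "family_of_matrix M \<gamma>"
    using family_of_matrix_iff_structure_matrices[OF cor M] str by simp
  with M show "\<exists>!M. family_of_matrix M \<gamma> \<and> twisting_matrix M"
    using twisting_matrix_of_family_unique by blast
qed

end
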